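(* Let $p\in[-1,1]$, $p\ne0$, and let $x^{(0)}=(x_1^{(0)},x_2^{(0)},0,1-x_1^{(0)}-x_2^{(0)},0)\in S^4$ be such that $x_1^{(0)}$, $x_2^{(0)}$ and $1-x_1^{(0)}-x_2^{(0)}$ are all non-zero and $(x_1^{(0)},x_2^{(0)},1-x_1^{(0)}-x_2^{(0)})\neq(\frac13,\frac13,\frac13)$. Then: - If $p>0$, then $\lim_{k\to\infty}W^{5k}(x^{(0)})=e_1$, $\lim_{k\to\infty}W^{5k+1}(x^{(0)})=e_2$, $\lim_{k\to\infty}W^{5k+2}(x^{(0)})=e_3$, $\lim_{k\to\infty}W^{5k+3}(x^{(0)})=e_4$, $\lim_{k\to\infty}W^{5k+4}(x^{(0)})=e_5$. - If $p<0$, then $\lim_{k\to\infty}W^{5k}(x^{(0)})=e_2$, $\lim_{k\to\infty}W^{5k+1}(x^{(0)})=e_3$, $\lim_{k\to\infty}W^{5k+2}(x^{(0)})=e_4$, $\lim_{k\to\infty}W^{5k+3}(x^{(0)})=e_5$, $\lim_{k\to\infty}W^{5k+4}(x^{(0)})=e_1$.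
   Context: $S^4=\{x=(x_1,\dots,x_5)\in\mathbb{R}^5: x_i\ge 0,\ \sum_{i=1}^5 x_i=1\}$. For $p\in[-1,1]$, the operator $W:S^4\to S^4$, $W(x)=x'$, is defined by $$\begin{aligned} x'_1&=x_5[1+p(x_1-x_2+x_3-x_4)],\\ x'_2&=x_1[1+p(x_2-x_3+x_4-x_5)],\\ x'_3&=x_2[1-p(x_1-x_3+x_4-x_5)],\\ x'_4&=x_3[1+p(x_1-x_2+x_4-x_5)],\\ x'_5&=x_4[1-p(x_1-x_2+x_3-x_5)]. \end{aligned}$$ $W^n$ is the $n$-th iterate of $W$, and $e_i$ is the $i$-th standard basis vector of $\mathbb{R}^5$ (a vertex of $S^4$). *)

theory Defs
  imports "HOL-Analysis.Analysis"
begin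

text \<open>The index type \<^typ>\<open>5\<close> is arithmetic modulo 5, so the index \<open>5\<close> is \<open>0\<close>; the indices
  \<open>1, \<dots>, 5\<close> are still pairwise distinct and exhaust the type.\<close>

lemma exhaust_5: "x = 1 \<or> x = 2 \<or> x = 3 \<or> x = 4 \<or> x = 5" for x :: 5
proof (induct x)
  case (of_int z)
  then have "z = 0 \<or> z = 1 \<or> z = 2 \<or> z = 3 \<or> z = 4" by fastforce
  then show ?case by auto
qed

lemma forall_5: "(\<forall>i::5. P i) \<longleftrightarrow> P 1 \<and> P 2 \<and> P 3 \<and> P 4 \<and> P 5"
  by (metis exhaust_5)

lemma UNIV_5: "UNIV = {1, 2, 3, 4, 5 :: 5}"
  using exhaust_5 by auto

lemma sum_5: "sum f (UNIV :: 5 set) = f 1 + f 2 + f 3 + f 4 + f 5"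
  unfolding UNIV_5 by (simp add: ac_simps)

lemma vector_5 [simp]:
  "(vector [a, b, c, d, e] :: 'a::zero ^ 5) $ 1 = a"
  "(vector [a, b, c, d, e] :: 'a::zero ^ 5) $ 2 = b"
  "(vector [a, b, c, d, e] :: 'a::zero ^ 5) $ 3 = c"
  "(vector [a, b, c, d, e] :: 'a::zero ^ 5) $ 4 = d"
  "(vector [a, b, c, d, e] :: 'a::zero ^ 5) $ 5 = e"
  unfolding vector_def by simp_all

definition S4 :: "(real ^ 5) set" where
  "S4 = {x. (\<forall>i. 0 \<le> x $ i) \<and> (\<Sum>i\<in>UNIV. x $ i) = 1}"

definition W :: "real \<Rightarrow> real ^ 5 \<Rightarrow> real ^ 5" where
  "W p x = vector
    [x $ 5 * (1 + p * (x $ 1 - x $ 2 + x $ 3 - x $ 4)),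
     x $ 1 * (1 + p * (x $ 2 - x $ 3 + x $ 4 - x $ 5)),
     x $ 2 * (1 - p * (x $ 1 - x $ 3 + x $ 4 - x $ 5)),
     x $ 3 * (1 + p * (x $ 1 - x $ 2 + x $ 4 - x $ 5)),
     x $ 4 * (1 - p * (x $ 1 - x $ 2 + x $ 3 - x $ 5))]"

lemma W_in_S4:
  assumes p: "- 1 \<le> p" "p \<le> 1" and x: "x \<in> S4"
  shows "W p x \<in> S4"
proof -
  have nn: "0 \<le> x $ 1" "0 \<le> x $ 2" "0 \<le> x $ 3" "0 \<le> x $ 4" "0 \<le> x $ 5"
    and s: "x $ 1 + x $ 2 + x $ 3 + x $ 4 + x $ 5 = 1"
    using x by (auto simp: S4_def sum_5)
  have bd: "0 \<le> 1 + p * t" "0 \<le> 1 - p * t" if "\<bar>t\<bar> \<le> 1" for t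
  proof -
    have "\<bar>p * t\<bar> \<le> 1 * 1"
      unfolding abs_mult using p that by (intro mult_mono) auto
    then show "0 \<le> 1 + p * t" "0 \<le> 1 - p * t" by auto
  qed
  have "\<forall>i. 0 \<le> W p x $ i"
    unfolding forall_5 W_def vector_5
    by (intro conjI mult_nonneg_nonneg nn bd) (use nn s in auto)
  moreover have "(\<Sum>i\<in>UNIV. W p x $ i) = x $ 1 + x $ 2 + x $ 3 + x $ 4 + x $ 5"
    unfolding sum_5 W_def vector_5 by (simp add: algebra_simps)
  ultimately show ?thesis by (simp add: S4_def s)
qed

end

theory Submission
  imports Defs
begin

text \<open>On a point supported on three coordinates \<open>i\<close>, \<open>i + 1\<close>, \<open>i + 3\<close> (indices modulo 5) the
  operator \<open>W p\<close> does two independent things. It shifts the support by one, and it acts on the three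
  masses \<open>a, b, c\<close> by one and the same map \<open>compete p\<close>, whatever \<open>i\<close> is: each pair of masses is in
  conflict, and the winner of a conflict gains \<open>\<bar>p\<bar>\<close> times the product of the pair. For \<open>p > 0\<close> the
  mass \<open>a\<close> beats \<open>b\<close> and \<open>c\<close>, and \<open>c\<close> beats \<open>b\<close>; for \<open>p < 0\<close> all outcomes are reversed.
  This is \<open>W_embed\<close>.

  So there is a mass, \<open>a\<close> or \<open>b\<close> according to the sign of \<open>p\<close>, that beats both others. As the total
  is 1, this mass \<open>w\<close> obeys the logistic law \<open>w' = w (1 + q (1 - w))\<close> with \<open>q = \<bar>p\<bar>\<close> and increases
  to 1 once it is positive (\<open>logistic_tendsto_1\<close>), while the others vanish. The orbit therefore
  approaches a vertex that moves one step along the 5-cycle of coordinates at each application of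
  \<open>W p\<close>. The point of the theorem has \<open>i = 1\<close>, which puts \<open>a\<close> at the first and \<open>b\<close> at the second
  coordinate.\<close>

section \<open>Logistic growth\<close>

text \<open>The deficit satisfies \<open>1 - w' = (1 - w) (1 - q w)\<close>. Since \<open>w\<close> never drops below its initial
  value, the deficit decays geometrically with ratio \<open>1 - q * w 0\<close>.\<close>

lemma logistic_tendsto_1:
  fixes w :: "nat \<Rightarrow> real"
  assumes q: "0 < q" "q \<le> 1" and pos: "0 < w 0" and le1: "\<And>n. w n \<le> 1"
    and step: "\<And>n. w (Suc n) = w n * (1 + q * (1 - w n))"
  shows "w \<longlonglongrightarrow> 1"
proof -
  define r where "r = 1 - q * w 0"
  have "q * w 0 \<le> 1 * 1"
    using q pos le1[of 0] by (intro mult_mono) auto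
  then have r: "0 \<le> r" "r < 1"
    using q pos by (auto simp: r_def)
  have bound: "w 0 \<le> w n \<and> 1 - w n \<le> r ^ n" for n
  proof (induction n)
    case 0
    then show ?case using pos by simp
  next
    case (Suc n)
    have "0 \<le> w n * (q * (1 - w n))"
      using q pos Suc le1[of n] by (intro mult_nonneg_nonneg) auto
    then have "w 0 \<le> w (Suc n)"
      using Suc by (simp add: step algebra_simps)
    moreover have "1 - q * w n \<le> r"
      using Suc q by (simp add: r_def)
    then have "(1 - q * w n) * (1 - w n) \<le> r * r ^ n"
      using Suc r le1[of n]
      by (meson diff_ge_0_iff_ge mult_left_mono mult_right_mono order_trans)
    moreover have "1 - w (Suc n) = (1 - q * w n) * (1 - w n)"
      by (simp add: step algebra_simps)
    ultimately show ?case by simp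
  qed
  have "(\<lambda>n. 1 - r ^ n) \<longlonglongrightarrow> 1 - 0"
    using r by (intro tendsto_intros LIMSEQ_power_zero) auto
  then show ?thesis
    using tendsto_sandwich[of "\<lambda>n. 1 - r ^ n" w sequentially "\<lambda>_. 1" 1] bound le1
    by (simp add: algebra_simps)
qed

section \<open>Competition of three masses\<close>

fun compete :: "real \<Rightarrow> real \<times> real \<times> real \<Rightarrow> real \<times> real \<times> real" where
  "compete p (a, b, c) = (a * (1 + p * (b + c)), b * (1 - p * (a + c)), c * (1 + p * (b - a)))"

definition triangle :: "(real \<times> real \<times> real) set" where
  "triangle = {(a, b, c). 0 \<le> a \<and> 0 \<le> b \<and> 0 \<le> c \<and> a + b + c = 1}"

lemma compete_in_triangle:
  assumes p: "\<bar>p\<bar> \<le> 1" and v: "v \<in> triangle"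
  shows "compete p v \<in> triangle"
proof -
  obtain a b c where [simp]: "v = (a, b, c)" by (cases v) auto
  have nn: "0 \<le> a" "0 \<le> b" "0 \<le> c" "a + b + c = 1"
    using v by (auto simp: triangle_def)
  have bd: "0 \<le> 1 + p * t" "0 \<le> 1 - p * t" if "\<bar>t\<bar> \<le> 1" for t
  proof -
    have "\<bar>p * t\<bar> \<le> 1 * 1"
      unfolding abs_mult using p that by (intro mult_mono) auto
    then show "0 \<le> 1 + p * t" "0 \<le> 1 - p * t" by auto
  qed
  have "0 \<le> a * (1 + p * (b + c))" "0 \<le> b * (1 - p * (a + c))" "0 \<le> c * (1 + p * (b - a))"
    by (intro mult_nonneg_nonneg nn bd; use nn in linarith)+
  moreover have "a * (1 + p * (b + c)) + b * (1 - p * (a + c)) + c * (1 + p * (b - a)) = a + b + c"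
    by (simp add: algebra_simps)
  ultimately show ?thesis
    using nn by (simp add: triangle_def)
qed

lemma compete_iterate_in_triangle:
  assumes "\<bar>p\<bar> \<le> 1" "v \<in> triangle"
  shows "(compete p ^^ n) v \<in> triangle"
  by (induction n) (simp_all add: assms compete_in_triangle)

text \<open>Among nonnegative masses of total 1, each one is at most the complement of any other. So the
  limit of the winning mass determines the limit of the whole triple.\<close>

lemma tendsto_0_if_complement_tendsto_1:
  fixes f g :: "nat \<Rightarrow> real"
  assumes "g \<longlonglongrightarrow> 1" "\<And>n. 0 \<le> f n" "\<And>n. f n \<le> 1 - g n"
  shows "f \<longlonglongrightarrow> 0"
proof -
  have "(\<lambda>n. 1 - g n) \<longlonglongrightarrow> 1 - 1"
    using assms(1) by (intro tendsto_intros)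
  then show ?thesis
    using tendsto_sandwich[of "\<lambda>_. 0" f sequentially "\<lambda>n. 1 - g n" 0] assms(2,3) by simp
qed

lemma compete_iterate_tendsto:
  assumes p: "\<bar>p\<bar> \<le> 1" and v: "v \<in> triangle"
  shows "0 < p \<Longrightarrow> 0 < fst v \<Longrightarrow> (\<lambda>n. (compete p ^^ n) v) \<longlonglongrightarrow> (1, 0, 0)"
    and "p < 0 \<Longrightarrow> 0 < fst (snd v) \<Longrightarrow> (\<lambda>n. (compete p ^^ n) v) \<longlonglongrightarrow> (0, 1, 0)"
proof -
  define a b c where "a n = fst ((compete p ^^ n) v)" and "b n = fst (snd ((compete p ^^ n) v))"
    and "c n = snd (snd ((compete p ^^ n) v))" for n
  have abc: "(compete p ^^ n) v = (a n, b n, c n)" for n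
    by (simp add: a_def b_def c_def)
  have inv: "0 \<le> a n" "0 \<le> b n" "0 \<le> c n" and total: "a n + b n + c n = 1" for n
    using compete_iterate_in_triangle[OF p v, of n] by (auto simp: abc triangle_def)
  have step: "(a (Suc n), b (Suc n), c (Suc n)) = compete p (a n, b n, c n)" for n
    using abc[of "Suc n"] by (simp add: abc)
  show "(\<lambda>n. (compete p ^^ n) v) \<longlonglongrightarrow> (1, 0, 0)" if "0 < p" "0 < fst v"
  proof -
    have rest: "b n + c n = 1 - a n" for n
      using total[of n] by linarith
    have a: "a \<longlonglongrightarrow> 1"
    proof (rule logistic_tendsto_1[of p])
      show "0 < a 0" using that by (simp add: a_def)
      show "a n \<le> 1" for n using inv[of n] total[of n] by linarith
      show "a (Suc n) = a n * (1 + p * (1 - a n))" for n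
        using step[of n] by (simp add: rest)
    qed (use p that in auto)
    have "b n \<le> 1 - a n" "c n \<le> 1 - a n" for n
      using inv[of n] total[of n] by linarith+
    then have "b \<longlonglongrightarrow> 0" "c \<longlonglongrightarrow> 0"
      using tendsto_0_if_complement_tendsto_1[OF a] inv by auto
    then show ?thesis unfolding abc using a by (intro tendsto_Pair)
  qed
  show "(\<lambda>n. (compete p ^^ n) v) \<longlonglongrightarrow> (0, 1, 0)" if "p < 0" "0 < fst (snd v)"
  proof -
    have rest: "a n + c n = 1 - b n" for n
      using total[of n] by linarith
    have b: "b \<longlonglongrightarrow> 1"
    proof (rule logistic_tendsto_1[of "- p"])
      show "0 < b 0" using that by (simp add: b_def)
      show "b n \<le> 1" for n using inv[of n] total[of n] by linarith
      show "b (Suc n) = b n * (1 + - p * (1 - b n))" for n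
        using step[of n] by (simp add: rest)
    qed (use p that in auto)
    have "a n \<le> 1 - b n" "c n \<le> 1 - b n" for n
      using inv[of n] total[of n] by linarith+
    then have "a \<longlonglongrightarrow> 0" "c \<longlonglongrightarrow> 0"
      using tendsto_0_if_complement_tendsto_1[OF b] inv by auto
    then show ?thesis unfolding abc using b by (intro tendsto_Pair)
  qed
qed

section \<open>Transport of the masses along the 5-cycle\<close>

fun embed :: "5 \<Rightarrow> real \<times> real \<times> real \<Rightarrow> real ^ 5" where
  "embed i (a, b, c) = a *\<^sub>R axis i 1 + b *\<^sub>R axis (i + 1) 1 + c *\<^sub>R axis (i + 3) 1"

text \<open>The formulas for \<open>W\<close> are not cyclically symmetric, so this is checked for each of the five
  positions \<open>i\<close> separately.\<close>

lemma W_embed: "W p (embed i v) = embed (i + 1) (compete p v)"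
proof -
  obtain a b c where v: "v = (a, b, c)" by (cases v) auto
  have "\<forall>i. W p (embed i (a, b, c)) = embed (i + 1) (compete p (a, b, c))"
    unfolding forall_5 vec_eq_iff W_def
    by (simp add: axis_def algebra_simps)
  then show ?thesis by (simp add: v)
qed

lemma W_iterate_embed: "(W p ^^ n) (embed i v) = embed (i + of_nat n) ((compete p ^^ n) v)"
  by (induction n) (simp_all add: W_embed ac_simps)

lemma tendsto_embed:
  assumes "(f \<longlongrightarrow> v) F"
  shows "((\<lambda>x. embed i (f x)) \<longlongrightarrow> embed i v) F"
proof -
  have embed_projections: "embed i w = fst w *\<^sub>R axis i 1 + fst (snd w) *\<^sub>R axis (i + 1) 1
      + snd (snd w) *\<^sub>R axis (i + 3) 1" for w
    by (cases w) auto
  show ?thesis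
    unfolding embed_projections by (intro tendsto_intros assms)
qed

text \<open>Along a residue class of \<open>n\<close> modulo 5 the support of the orbit stands still, so convergence of
  the masses gives convergence of the orbit.\<close>

lemma W_iterate_embed_tendsto:
  assumes "(\<lambda>n. (compete p ^^ n) v) \<longlonglongrightarrow> (a, b, c)"
  shows "(\<lambda>k. (W p ^^ (5 * k + r)) (embed i v)) \<longlonglongrightarrow> embed (i + of_nat r) (a, b, c)"
proof -
  have five: "(5 :: 5) = 0" by simp
  have index: "i + of_nat (5 * k + r) = i + (of_nat r :: 5)" for k
    by (simp only: of_nat_add of_nat_mult of_nat_numeral five) simp
  have "strict_mono (\<lambda>k. 5 * k + r)" by (simp add: strict_mono_def)
  from LIMSEQ_subseq_LIMSEQ[OF assms this]
  have "(\<lambda>k. (compete p ^^ (5 * k + r)) v) \<longlonglongrightarrow> (a, b, c)" by (simp add: o_def)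
  then show ?thesis
    unfolding W_iterate_embed index by (rule tendsto_embed)
qed

theorem theorem3:
  fixes p x1 x2 :: real and x0 :: "real ^ 5"
  assumes "p \<in> {-1..1}" and "p \<noteq> 0"
    and "x0 = vector [x1, x2, 0, 1 - x1 - x2, 0]"
    and "x0 \<in> S4"
    and "x1 \<noteq> 0" and "x2 \<noteq> 0" and "1 - x1 - x2 \<noteq> 0"
    and "(x1, x2, 1 - x1 - x2) \<noteq> (1/3, 1/3, 1/3)"
  shows "(p > 0 \<longrightarrow>
            (\<lambda>k. (W p ^^ (5 * k)) x0) \<longlonglongrightarrow> axis 1 1 \<and>
            (\<lambda>k. (W p ^^ (5 * k + 1)) x0) \<longlonglongrightarrow> axis 2 1 \<and>
            (\<lambda>k. (W p ^^ (5 * k + 2)) x0) \<longlonglongrightarrow> axis 3 1 \<and>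
            (\<lambda>k. (W p ^^ (5 * k + 3)) x0) \<longlonglongrightarrow> axis 4 1 \<and>
            (\<lambda>k. (W p ^^ (5 * k + 4)) x0) \<longlonglongrightarrow> axis 5 1) \<and>
         (p < 0 \<longrightarrow>
            (\<lambda>k. (W p ^^ (5 * k)) x0) \<longlonglongrightarrow> axis 2 1 \<and>
            (\<lambda>k. (W p ^^ (5 * k + 1)) x0) \<longlonglongrightarrow> axis 3 1 \<and>
            (\<lambda>k. (W p ^^ (5 * k + 2)) x0) \<longlonglongrightarrow> axis 4 1 \<and>
            (\<lambda>k. (W p ^^ (5 * k + 3)) x0) \<longlonglongrightarrow> axis 5 1 \<and>
            (\<lambda>k. (W p ^^ (5 * k + 4)) x0) \<longlonglongrightarrow> axis 1 1)"
proof -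
  define v where "v = (x1, x2, 1 - x1 - x2)"
  have x0: "x0 = embed 1 v"
    by (simp add: assms(3) v_def vec_eq_iff forall_5 axis_def)
  have v: "v \<in> triangle" and pos: "0 < fst v" "0 < fst (snd v)"
    using assms(4-6) by (auto simp: assms(3) S4_def forall_5 triangle_def v_def)
  have p: "\<bar>p\<bar> \<le> 1" using assms(1) by auto
  show ?thesis
  proof (intro conjI impI)
    assume "p > 0"
    note lim = W_iterate_embed_tendsto[OF compete_iterate_tendsto(1)[OF p v this pos(1)],
        where i = 1, folded x0]
    show "(\<lambda>k. (W p ^^ (5 * k)) x0) \<longlonglongrightarrow> axis 1 1" using lim[of 0] by simp
    show "(\<lambda>k. (W p ^^ (5 * k + 1)) x0) \<longlonglongrightarrow> axis 2 1" using lim[of 1] by simp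
    show "(\<lambda>k. (W p ^^ (5 * k + 2)) x0) \<longlonglongrightarrow> axis 3 1" using lim[of 2] by simp
    show "(\<lambda>k. (W p ^^ (5 * k + 3)) x0) \<longlonglongrightarrow> axis 4 1" using lim[of 3] by simp
    show "(\<lambda>k. (W p ^^ (5 * k + 4)) x0) \<longlonglongrightarrow> axis 5 1" using lim[of 4] by simp
  next
    assume "p < 0"
    note lim = W_iterate_embed_tendsto[OF compete_iterate_tendsto(2)[OF p v this pos(2)],
        where i = 1, folded x0]
    show "(\<lambda>k. (W p ^^ (5 * k)) x0) \<longlonglongrightarrow> axis 2 1" using lim[of 0] by simp
    show "(\<lambda>k. (W p ^^ (5 * k + 1)) x0) \<longlonglongrightarrow> axis 3 1" using lim[of 1] by simp
    show "(\<lambda>k. (W p ^^ (5 * k + 2)) x0) \<longlonglongrightarrow> axis 4 1" using lim[of 2] by simp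
    show "(\<lambda>k. (W p ^^ (5 * k + 3)) x0) \<longlonglongrightarrow> axis 5 1" using lim[of 3] by simp
    show "(\<lambda>k. (W p ^^ (5 * k + 4)) x0) \<longlonglongrightarrow> axis 1 1"
    proof -
      have six: "(6 :: 5) = 1" by simp
      show ?thesis using lim[of 4] by (simp add: six)
    qed
  qed
qed

end
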